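(* Let $g:X\to\mathbb{R}$, let $A\in\mathbb{I}^{n_x\times N}$ be such that $\Gamma(\cdot,A,X)$ is an interval superposition model (ISM) of $g$ on $X$, and let $\alpha$ be a univariate atom operation, i.e. a real-valued function defined on an interval containing $\left[\sum_{i=1}^{n_x}L(A_i),\ \sum_{i=1}^{n_x}U(A_i)\right]$. Suppose that $C\in\mathbb{I}^{n_x\times N}$ is computed from $A$ and $\alpha$ by the following procedure (univariate composition rule). (1) Choose, for all $i\in\{1,\ldots,n_x\}$, points $a_i\in\mathbb{R}$ with $L(A_i)\le a_i\le U(A_i)$, and set $\omega=\sum_{i=1}^{n_x}a_i$. (2) Choose a remainder bound $r_\alpha(A)\ge 0$ such that $$\left|\sum_{i=1}^{n_x}\alpha(\omega+\delta_i)-(n_x-1)\alpha(\omega)-\alpha\left(\omega+\sum_{i=1}^{n_x}\delta_i\right)\right|\le r_\alpha(A)$$ for all $\delta\in\mathbb{R}^{n_x}$ with $L(A_i)\le a_i+\delta_i\le U(A_i)$ for all $i\in\{1,\ldots,n_x\}$. (3) For all $i\in\{1,\ldots,n_x\}$ and all $j\in\{1,\ldots,N\}$ compute the intervals $$C_i^j=\alpha\left(\omega-a_i+A_i^j\right)-\frac{n_x-1}{n_x}\alpha(\omega),$$ where $\alpha(\omega-a_i+A_i^j)$ is evaluated in interval arithmetic. (4) Pick $k\in\operatorname{argmax}_{i\in\{1,\ldots,n_x\}}\sum_{j=1}^{N}\left(\overline{A}_i^j-\underline{A}_i^j\right)$ and replace $C_k^j$ by $C_k^j+r_\alpha(A)\cdot[-1,1]$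 for all $j\in\{1,\ldots,N\}$. Then $\Gamma(\cdot,C,X)$ is an ISM of $\alpha\circ g$ on $X$, i.e. $\alpha(g(x))\in\Gamma(x,C,X)$ for all $x\in X$.
   Context: Let $n_x,N\ge 1$ be integers. $\mathbb{I}$ denotes the set of compact intervals $[a,b]\subset\mathbb{R}$ with $a\le b$, and $\mathbb{I}^{n_x\times N}$ the set of $n_x\times N$ matrices with entries in $\mathbb{I}$. The entries of $A\in\mathbb{I}^{n_x\times N}$ are written $A_i^j=[\underline{A}_i^j,\overline{A}_i^j]$, with row index $i\in\{1,\ldots,n_x\}$ and column index $j\in\{1,\ldots,N\}$; $A_i$ is the $i$-th row, and $$L(A_i)=\min_{j\in\{1,\ldots,N\}}\underline{A}_i^j,\qquad U(A_i)=\max_{j\in\{1,\ldots,N\}}\overline{A}_i^j .$$ Interval operations: $[a,b]+[c,d]=[a+c,b+d]$, $c+[a,b]=[a+c,b+c]$, and $c[a,b]=[ca,cb]$ if $c\ge 0$, $c[a,b]=[cb,ca]$ if $c<0$. Evaluating a univariate function $\alpha$ on an interval $I$ in interval arithmetic yields a compact interval $\alpha(I)$ containing $\{\alpha(t)\mid t\in I\}$ (e.g. $\exp([a,b])=[\exp(a),\exp(b)]$). Let $X=[\underline{x}_1,\overline{x}_1]\times\cdots\times[\underline{x}_{n_x},\overline{x}_{n_x}]$ be a box, $h_i=(\overline{x}_i-\underline{x}_i)/N$, and partition each coordinate range into $N$ pieces $X_i^j$ with endpoints $\underline{x}_i+(j-1)h_i$ and $\underline{x}_i+jh_i$. The pieces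 are taken closed on the left and open on the right for $j<N$, and closed on both sides for $j=N$, so that each $x_i\in[\underline{x}_i,\overline{x}_i]$ lies in exactly one $X_i^j$. Let $\varphi_i^j(x)=1$ if $x_i\in X_i^j$ and $\varphi_i^j(x)=0$ otherwise. For $A\in\mathbb{I}^{n_x\times N}$ define the interval-valued function $$\Gamma(x,A,X)=\sum_{i=1}^{n_x}\sum_{j=1}^{N}A_i^j\varphi_i^j(x),\qquad x\in X,$$ with sums of intervals (Minkowski sums) given by $[a,b]+[c,d]=[a+c,b+d]$. $\Gamma(\cdot,A,X)$ is called an interval superposition model (ISM) of a function $f:X\to\mathbb{R}$ on $X$ if $f(x)\in\Gamma(x,A,X)$ for all $x\in X$. *)

theory Defs
  imports "HOL-Analysis.Analysis" "HOL-Library.Interval"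
begin

text \<open>
  The type \<^typ>\<open>real interval\<close> consists of the nonempty compact intervals. A real \<open>c\<close> acts on
  intervals through the degenerate interval \<^term>\<open>interval_of c\<close>; the next two lemmas confirm that
  \<open>interval_of c + I\<close> and \<open>interval_of c * I\<close> are the shift \<open>c + [a, b]\<close> and the multiple
  \<open>c [a, b]\<close> given by the usual case distinction on the sign of \<open>c\<close>.
\<close>

lemma interval_of_plus_bounds:
  fixes c :: real and I :: "real interval"
  shows "lower (interval_of c + I) = lower I + c"
    and "upper (interval_of c + I) = upper I + c"
  by simp_all

lemma interval_of_times_bounds:
  fixes c :: real and I :: "real interval"
  shows "lower (interval_of c * I) = (if c \<ge> 0 then c * lower I else c * upper I)"
    and "upper (interval_of c * I) = (if c \<ge> 0 then c * upper I else c * lower I)"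
proof -
  have le: "lower I \<le> upper I" by simp
  have "c * lower I \<le> c * upper I" if "c \<ge> 0" using le that by (rule mult_left_mono)
  moreover have "c * upper I \<le> c * lower I" if "\<not> c \<ge> 0"
    using le that by (intro mult_left_mono_neg) auto
  ultimately show "lower (interval_of c * I) = (if c \<ge> 0 then c * lower I else c * upper I)"
    and "upper (interval_of c * I) = (if c \<ge> 0 then c * upper I else c * lower I)"
    by (cases "c \<ge> 0"; simp add: lower_times upper_times)+
qed

text \<open>
  The coordinates are indexed by a finite type \<open>'n\<close>, so the dimension is \<^term>\<open>CARD('n)\<close>. A box is
  a vector of intervals. An interval matrix with \<open>N\<close> columns is a function of the row index and
  the column index, of which only the columns \<open>1, ..., N\<close> are used.
\<close>

definition box_set :: "real interval ^ 'n \<Rightarrow> (real ^ 'n) set" where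
  "box_set X = {x. \<forall>i. x $ i \<in> set_of (X $ i)}"

definition row_L :: "nat \<Rightarrow> (nat \<Rightarrow> real interval) \<Rightarrow> real" where
  "row_L N R = Min ((\<lambda>j. lower (R j)) ` {1..N})"

definition row_U :: "nat \<Rightarrow> (nat \<Rightarrow> real interval) \<Rightarrow> real" where
  "row_U N R = Max ((\<lambda>j. upper (R j)) ` {1..N})"

definition piece :: "nat \<Rightarrow> real interval ^ 'n \<Rightarrow> 'n \<Rightarrow> nat \<Rightarrow> real set" where
  "piece N X i j =
    (let h = (upper (X $ i) - lower (X $ i)) / real N;
         l = lower (X $ i) + (real j - 1) * h;
         u = lower (X $ i) + real j * h
     in if j < N then {l..<u} else {l..u})"

definition ism_basis :: "nat \<Rightarrow> real interval ^ 'n \<Rightarrow> 'n \<Rightarrow> nat \<Rightarrow> real ^ 'n \<Rightarrow> real" where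
  "ism_basis N X i j x = (if x $ i \<in> piece N X i j then 1 else 0)"

definition ism_eval ::
  "nat \<Rightarrow> real ^ 'n \<Rightarrow> ('n \<Rightarrow> nat \<Rightarrow> real interval) \<Rightarrow> real interval ^ 'n \<Rightarrow> real interval" where
  "ism_eval N x A X = (\<Sum>i\<in>UNIV. \<Sum>j=1..N. interval_of (ism_basis N X i j x) * A i j)"

definition is_ism ::
  "nat \<Rightarrow> ('n \<Rightarrow> nat \<Rightarrow> real interval) \<Rightarrow> real interval ^ 'n \<Rightarrow> (real ^ 'n \<Rightarrow> real) \<Rightarrow> bool" where
  "is_ism N A X f \<longleftrightarrow> (\<forall>x\<in>box_set X. f x \<in> set_of (ism_eval N x A X))"

text \<open>
  \<open>F\<close> is an interval-arithmetic evaluation of a function \<open>f\<close> with domain \<open>D\<close>: it encloses the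
  range of \<open>f\<close> on every compact interval inside \<open>D\<close>, but need not be the exact range. Values of
  \<open>f\<close> outside \<open>D\<close> are irrelevant.
\<close>

definition interval_evaluation ::
  "real set \<Rightarrow> (real \<Rightarrow> real) \<Rightarrow> (real interval \<Rightarrow> real interval) \<Rightarrow> bool" where
  "interval_evaluation D f F \<longleftrightarrow> (\<forall>I. set_of I \<subseteq> D \<longrightarrow> f ` set_of I \<subseteq> set_of (F I))"

end

theory Submission
  imports Defs
begin

text \<open>
  At a fixed point \<open>x\<close> exactly one piece of every coordinate range contains the coordinate of \<open>x\<close>
  (\<open>ex1_piece\<close>). An interval superposition model therefore evaluates at \<open>x\<close> to a Minkowski sum with a
  single interval per row (\<open>ism_eval_eq_sum_column\<close>), and membership in such a sum means being a
  sum of members (\<open>set_of_sum_iff\<close>). So the model property of \<open>A\<close> yields \<open>g x = (\<Sum>i. y i)\<close>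
  with \<open>y i\<close> in the active interval of row \<open>i\<close>.

  Put \<open>\<delta> i = y i - a i\<close>; then \<open>\<omega> + (\<Sum>i. \<delta> i) = g x\<close>. The remainder bound compares
  \<open>\<alpha> (g x)\<close> with the separable expression
  \<open>(\<Sum>i. \<alpha> (\<omega> + \<delta> i)) - (n - 1) \<alpha> \<omega>\<close>, with an error \<open>e\<close> of absolute value at most \<open>r\<close>.
  Distributing the constant \<open>(n - 1) \<alpha> \<omega>\<close> evenly over the \<open>n\<close> rows and charging \<open>e\<close> to
  row \<open>k\<close> writes \<open>\<alpha> (g x)\<close> as a sum with one summand per row. The summand of each row lies in the
  active interval of \<open>C\<close>, because \<open>\<omega> + \<delta> i = (\<omega> - a i) + y i\<close> lies in the shifted interval on
  which the interval evaluation of \<open>\<alpha>\<close> is taken.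
\<close>

text \<open>
  An element of a sum of two intervals splits into elements of the summands. Hence \<^const>\<open>set_of\<close> is
  a homomorphism into sets with elementwise addition, where finite sums have this description.
\<close>

lemma set_of_sum_iff:
  fixes I :: "'i \<Rightarrow> 'a :: linordered_ab_group_add interval"
  assumes "finite S"
  shows "t \<in> set_of (\<Sum>i\<in>S. I i) \<longleftrightarrow> (\<exists>y. t = (\<Sum>i\<in>S. y i) \<and> (\<forall>i\<in>S. y i \<in> set_of (I i)))"
proof -
  have "set_of (0 :: 'a interval) = 0"
    by (auto simp: set_of_eq)
  then have "set_of (\<Sum>i\<in>S. I i) = (\<Sum>i\<in>S. set_of (I i))"
    using sum_comp_morphism[of set_of I S] by (simp add: set_of_plus o_def)
  then show ?thesis
    using set_sum_alt[OF assms, of "\<lambda>i. set_of (I i)"] by auto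
qed

text \<open>
  The active column is the least \<open>j\<close> whose right endpoint exceeds the coordinate, or \<open>N\<close> if there is
  none; minimality gives the left endpoint condition. Phrased this way the argument needs no
  division by the width of the pieces, so it covers a degenerate coordinate range, where all pieces
  but the last are empty.
\<close>

lemma ex1_piece:
  fixes X :: "real interval ^ 'n"
  assumes "N \<ge> 1" and x: "t \<in> set_of (X $ i)"
  shows "\<exists>!j. j \<in> {1..N} \<and> t \<in> piece N X i j"
proof (rule ex_ex1I)
  define h where "h = (upper (X $ i) - lower (X $ i)) / real N"
  define l where "l = lower (X $ i)"
  have h: "h \<ge> 0" by (simp add: h_def)
  have end_N: "l + real N * h = upper (X $ i)"
    using \<open>N \<ge> 1\<close> by (simp add: h_def l_def)
  have piece_iff: "t \<in> piece N X i j \<longleftrightarrow>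
      l + (real j - 1) * h \<le> t \<and> (if j < N then t < l + real j * h else t \<le> l + real j * h)" for j
    by (simp add: piece_def Let_def h_def l_def)
  have bounds: "l \<le> t" "t \<le> upper (X $ i)"
    using x by (auto simp: set_of_eq l_def)
  define P where "P j \<longleftrightarrow> 1 \<le> j \<and> (j = N \<or> t < l + real j * h)" for j
  define J where "J = (LEAST j. P j)"
  have "P N" using \<open>N \<ge> 1\<close> by (simp add: P_def)
  then have PJ: "P J" and JN: "J \<le> N"
    unfolding J_def by (auto intro: LeastI Least_le)
  have "l + (real J - 1) * h \<le> t"
  proof (cases "J = 1")
    case False
    with PJ have "J - 1 < J" "1 \<le> J - 1" by (auto simp: P_def)
    moreover from this(1) have "\<not> P (J - 1)" unfolding J_def by (rule not_less_Least)
    ultimately show ?thesis by (auto simp: P_def of_nat_diff)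
  qed (simp add: bounds)
  moreover have "if J < N then t < l + real J * h else t \<le> l + real J * h"
    using PJ JN bounds end_N by (auto simp: P_def)
  ultimately have "t \<in> piece N X i J" by (simp add: piece_iff)
  with PJ JN show "\<exists>j. j \<in> {1..N} \<and> t \<in> piece N X i j"
    by (auto simp: P_def)
  have le: "j \<le> j'" if "j \<in> {1..N} \<and> t \<in> piece N X i j" "j' \<in> {1..N} \<and> t \<in> piece N X i j'" for j j'
  proof (rule ccontr)
    assume "\<not> j \<le> j'"
    then have "j' < N" "real j' \<le> real j - 1" using that by auto
    have "t < l + real j' * h" using that \<open>j' < N\<close> by (simp add: piece_iff)
    also have "\<dots> \<le> l + (real j - 1) * h"
      using \<open>real j' \<le> real j - 1\<close> h by (simp add: mult_right_mono)
    also have "\<dots> \<le> t" using that by (simp add: piece_iff)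
    finally show False by simp
  qed
  show "j = j'" if "j \<in> {1..N} \<and> t \<in> piece N X i j" "j' \<in> {1..N} \<and> t \<in> piece N X i j'" for j j'
    using le[OF that] le[OF that(2,1)] by simp
qed

text \<open>
  The active columns depend on the point and the partition only, so a single selection \<open>J\<close> serves
  all matrices. Two models can then be compared row by row.
\<close>

lemma ism_eval_eq_sum_column:
  fixes X :: "real interval ^ 'n"
  assumes "N \<ge> 1" and "x \<in> box_set X"
  obtains J where "\<And>i. J i \<in> {1..N}" and "\<And>A. ism_eval N x A X = (\<Sum>i\<in>UNIV. A i (J i))"
proof -
  have "\<forall>i. \<exists>!j. j \<in> {1..N} \<and> x $ i \<in> piece N X i j"
  proof
    have "x $ i \<in> set_of (X $ i)" for i
      using assms(2) by (simp add: box_set_def)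
    then show "\<exists>!j. j \<in> {1..N} \<and> x $ i \<in> piece N X i j" for i
      by (rule ex1_piece[OF \<open>N \<ge> 1\<close>])
  qed
  then obtain J where J: "\<And>i. J i \<in> {1..N}" "\<And>i. x $ i \<in> piece N X i (J i)"
    and uniq: "\<And>i j. j \<in> {1..N} \<Longrightarrow> x $ i \<in> piece N X i j \<Longrightarrow> j = J i"
    by metis
  have "(\<Sum>j=1..N. interval_of (ism_basis N X i j x) * A i j) = A i (J i)"
    for A :: "'n \<Rightarrow> nat \<Rightarrow> real interval" and i
  proof -
    have "interval_of (ism_basis N X i j x) * A i j = (if j = J i then A i j else 0)"
      if "j \<in> {1..N}" for j
    proof -
      have "x $ i \<in> piece N X i j \<longleftrightarrow> j = J i"
        using J(2) uniq[OF that] by blast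
      then show ?thesis
        by (simp add: ism_basis_def interval_eq_iff interval_of_times_bounds)
    qed
    then show ?thesis using J(1)[of i] by (simp add: sum.delta)
  qed
  then show ?thesis using that[of J] J(1) by (simp add: ism_eval_def)
qed

lemma entry_bounds:
  assumes "j \<in> {1..N}" and "t \<in> set_of (R j)"
  shows "row_L N R \<le> t" and "t \<le> row_U N R"
proof -
  have "row_L N R \<le> lower (R j)" "upper (R j) \<le> row_U N R"
    using assms(1) by (auto simp: row_L_def row_U_def intro!: Min_le Max_ge)
  then show "row_L N R \<le> t" "t \<le> row_U N R"
    using assms(2) by (auto simp: set_of_eq)
qed

theorem theorem1:
  fixes N :: nat
    and X :: "real interval ^ 'n"
    and g :: "real ^ 'n \<Rightarrow> real"
    and A C C0 :: "'n \<Rightarrow> nat \<Rightarrow> real interval"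
    and D :: "real set"
    and \<alpha> :: "real \<Rightarrow> real"
    and \<alpha>I :: "real interval \<Rightarrow> real interval"
    and a :: "real ^ 'n"
    and \<omega> r :: real
    and k :: 'n
  assumes N: "N \<ge> 1"
    and ism_g: "is_ism N A X g"
    and domain_interval: "is_interval D"
    and domain: "{(\<Sum>i\<in>UNIV. row_L N (A i)) .. (\<Sum>i\<in>UNIV. row_U N (A i))} \<subseteq> D"
    and eval: "interval_evaluation D \<alpha> \<alpha>I"
    and a_bounds: "\<And>i. row_L N (A i) \<le> a $ i \<and> a $ i \<le> row_U N (A i)"
    and \<omega>: "\<omega> = (\<Sum>i\<in>UNIV. a $ i)"
    and r_nonneg: "r \<ge> 0"
    and remainder: "\<And>\<delta> :: real ^ 'n.
          (\<And>i. row_L N (A i) \<le> a $ i + \<delta> $ i \<and> a $ i + \<delta> $ i \<le> row_U N (A i)) \<Longrightarrow>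
          \<bar>(\<Sum>i\<in>UNIV. \<alpha> (\<omega> + \<delta> $ i)) - (real CARD('n) - 1) * \<alpha> \<omega>
             - \<alpha> (\<omega> + (\<Sum>i\<in>UNIV. \<delta> $ i))\<bar> \<le> r"
    and step3: "\<And>i j. j \<in> {1..N} \<Longrightarrow>
          C0 i j = \<alpha>I (interval_of (\<omega> - a $ i) + A i j)
                     - interval_of ((real CARD('n) - 1) / real CARD('n) * \<alpha> \<omega>)"
    and argmax: "is_arg_max (\<lambda>i. \<Sum>j=1..N. upper (A i j) - lower (A i j)) (\<lambda>i. i \<in> UNIV) k"
    and step4: "\<And>i j. j \<in> {1..N} \<Longrightarrow>
          C i j = (if i = k then C0 i j + interval_of r * Interval (-1, 1) else C0 i j)"
  shows "is_ism N C X (\<alpha> \<circ> g)"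
proof -
  have "\<alpha> (g x) \<in> set_of (ism_eval N x C X)" if x: "x \<in> box_set X" for x
  proof -
    obtain J where J: "\<And>i. J i \<in> {1..N}"
      and eval_J: "\<And>A. ism_eval N x A X = (\<Sum>i\<in>UNIV. A i (J i))"
      using ism_eval_eq_sum_column[OF N x] by metis
    have "g x \<in> set_of (\<Sum>i\<in>UNIV. A i (J i))"
      using ism_g x unfolding is_ism_def eval_J[symmetric] by blast
    then obtain y where gx: "g x = (\<Sum>i\<in>UNIV. y i)" and y: "\<And>i. y i \<in> set_of (A i (J i))"
      by (auto simp: set_of_sum_iff)
    define \<delta> :: "real ^ 'n" where "\<delta> = (\<chi> i. y i - a $ i)"
    define n where "n = real CARD('n)"
    have n: "n > 0" by (simp add: n_def)
    have sum_\<delta>: "\<omega> + (\<Sum>i\<in>UNIV. \<delta> $ i) = g x"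
      by (simp add: \<delta>_def \<omega> gx sum_subtractf)
    define e where "e = \<alpha> (g x) - ((\<Sum>i\<in>UNIV. \<alpha> (\<omega> + \<delta> $ i)) - (n - 1) * \<alpha> \<omega>)"
    have "row_L N (A i) \<le> a $ i + \<delta> $ i \<and> a $ i + \<delta> $ i \<le> row_U N (A i)" for i
      using entry_bounds[where R = "A i", OF J y] by (simp add: \<delta>_def)
    then have "\<bar>(\<Sum>i\<in>UNIV. \<alpha> (\<omega> + \<delta> $ i)) - (n - 1) * \<alpha> \<omega> - \<alpha> (g x)\<bar> \<le> r"
      using remainder[of \<delta>] by (simp only: sum_\<delta> n_def)
    then have e: "\<bar>e\<bar> \<le> r" by (simp add: e_def)
    define z where
      "z i = \<alpha> (\<omega> + \<delta> $ i) - (n - 1) / n * \<alpha> \<omega> + (if i = k then e else 0)" for i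
    have "(\<Sum>i\<in>UNIV. z i)
        = (\<Sum>i\<in>UNIV. \<alpha> (\<omega> + \<delta> $ i)) - n * ((n - 1) / n * \<alpha> \<omega>) + e"
      by (simp add: z_def sum.distrib sum_subtractf n_def)
    also have "\<dots> = \<alpha> (g x)" using n by (simp add: e_def)
    finally have z_sum: "\<alpha> (g x) = (\<Sum>i\<in>UNIV. z i)" by simp
    have z_mem: "z i \<in> set_of (C i (J i))" for i
    proof -
      let ?I = "interval_of (\<omega> - a $ i) + A i (J i)"
      (* The arguments of \<alpha> stay in its domain: replacing only the i-th summand of \<omega> = (\<Sum>m. a m) by a value t between the bounds of
         row i keeps the sum between the sums of the row bounds. *)
      have "set_of ?I \<subseteq> D"
      proof
        fix s assume "s \<in> set_of ?I"
        then obtain c t where "s = c + t" "c \<in> set_of (interval_of (\<omega> - a $ i))"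
          and t: "t \<in> set_of (A i (J i))"
          by (rule plus_in_intervalE)
        then have s: "s = \<omega> - a $ i + t" by (simp add: set_of_eq)
        have "s = (\<Sum>m\<in>UNIV. if m = i then t else a $ m)"
          by (simp add: s \<omega> sum.remove[of UNIV i])
        also have "\<dots> \<in> {(\<Sum>i\<in>UNIV. row_L N (A i)) .. (\<Sum>i\<in>UNIV. row_U N (A i))}"
          using a_bounds entry_bounds[where R = "A i", OF J t] by (auto intro!: sum_mono)
        finally show "s \<in> D" using domain by blast
      qed
      moreover have "\<omega> + \<delta> $ i \<in> set_of ?I"
        using y[of i] by (auto simp: set_of_eq \<delta>_def)
      ultimately have "\<alpha> (\<omega> + \<delta> $ i) \<in> set_of (\<alpha>I ?I)"
        using eval by (auto simp: interval_evaluation_def)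
      then have C0: "\<alpha> (\<omega> + \<delta> $ i) - (n - 1) / n * \<alpha> \<omega> \<in> set_of (C0 i (J i))"
        unfolding step3[OF J] n_def by (intro minus_in_intervalI in_interval_to_interval)
      have "lower (Interval (-1, 1 :: real)) = -1" "upper (Interval (-1, 1 :: real)) = 1"
        by (simp_all add: lower.rep_eq upper.rep_eq Interval_inverse)
      then have "e \<in> set_of (interval_of r * Interval (-1, 1))"
        using e r_nonneg by (auto simp: set_of_eq interval_of_times_bounds)
      then show ?thesis
        using C0 by (auto simp: step4[OF J] z_def intro!: plus_in_intervalI)
    qed
    show ?thesis
      unfolding eval_J by (subst set_of_sum_iff) (use z_sum z_mem in auto)
  qed
  then show ?thesis by (simp add: is_ism_def)
qed

end
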